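(* Let $T>0$ and let $a\colon\mathbb{R}\to\mathbb{R}$ be a locally integrable $T$-periodic function such that $\int_0^T a(t)\,dt<0$ and such that there exist $m\ge1$ intervals $I_1^+,\dots,I_m^+$, closed and pairwise disjoint in the quotient space $\mathbb{R}/T\mathbb{Z}$, with $a(t)\ge0$ for a.e. $t\in I_i^+$ and $a\not\equiv0$ on $I_i^+$ for $i=1,\dots,m$, and $a(t)\le0$ for a.e. $t\in(\mathbb{R}/T\mathbb{Z})\setminus\bigcup_{i=1}^m I_i^+$. Let $g\colon[0,+\infty)\to[0,+\infty)$ be a continuous function with $g(0)=0$ and $g(u)>0$ for $u>0$. Suppose that at least one of the following holds: (1) $\lim_{u\to0^+}g(u)/u=0$ and $\lim_{u\to0^+,\ \omega\to1}g(\omega u)/g(u)=1$; (2) there exists $\varepsilon>0$ such that $g\in\mathcal{C}^1([0,\varepsilon))$ and $g'(0)=0$. Let $\rho^*,\lambda^*$ be as described in the context, and let $\{u_{s,\lambda}(t)\}_{\lambda>\lambda^*}$ be a family of positive $T$-periodic solutions to $$\left(\frac{u'}{\sqrt{1-(u')^2}}\right)'+\lambda a(t)g(u)=0$$ with $\|u_{s,\lambda}\|_\infty<\rho^*$. Then, for every $p\in[1,+\infty)$, it holds that $$u_{s,\lambda}\to0\quad\text{in }W^{1,p}_T,\text{ as }\lambda\to+\infty.$$ In particular, $u_{s,\lambda}(t)$ converges to zero uniformly in $t$, as $\lambda\to+\infty$.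
   Context: Set $\varphi(\xi)=\xi/\sqrt{1-\xi^2}$ for $\xi\in(-1,1)$. A solution of $(\varphi(u'))'+\lambda a(t)g(u)=0$ is a continuously differentiable function $u$ (with $|u'|<1$) such that $t\mapsto\varphi(u'(t))$ is locally absolutely continuous and the equation holds for almost every $t$. A $T$-periodic solution is a solution defined on $\mathbb{R}$ with $u(t+T)=u(t)$ for all $t$; it is positive if $u(t)>0$ for all $t\in\mathbb{R}$. $\|\cdot\|_\infty$ is the sup-norm. $W^{1,p}_T$ is the Sobolev space of $T$-periodic functions, with the usual $W^{1,p}(0,T)$ norm. "$a\not\equiv0$ on an interval" means $a$ is not a.e. zero there. Limits as $u\to0^+$ and $\omega\to1$ are joint limits. Constants $\rho^*,\lambda^*$: write $I_i^+=[\sigma_i,\tau_i]$ and $|I_i^+|=\tau_i-\sigma_i$. The number $\rho^*>0$ is fixed so that $\rho^*<|I_i^+|/4$ and $\int_{\sigma_i+2\rho^*}^{\tau_i-2\rho^*}a(t)\,dt>0$ for every $i=1,\dots,m$, and $$\lambda^*=\max_{i=1,\dots,m}\frac{2\varphi(1/2)}{\min\{g(u)\colon u\in[2(\rho^* )^2/|I_i^+|,\rho^*]\}\int_{\sigma_i+2\rho^*}^{\tau_i-2\rho^*}a(t)\,dt}.$$ (With this choice, for every $\lambda>\lambda^*$ there exists at least one positive $T$-periodic solution with sup-norm smaller than $\rho^*$.) *)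

theory Defs
  imports "HOL-Analysis.Analysis"
begin

definition phi :: "real \<Rightarrow> real" where
  "phi \<xi> = \<xi> / sqrt (1 - \<xi>\<^sup>2)"

definition periodic :: "real \<Rightarrow> (real \<Rightarrow> 'a) \<Rightarrow> bool" where
  "periodic T f \<longleftrightarrow> (\<forall>t. f (t + T) = f t)"

definition locally_integrable :: "(real \<Rightarrow> real) \<Rightarrow> bool" where
  "locally_integrable f \<longleftrightarrow> (\<forall>c d. f absolutely_integrable_on {c..d})"

text \<open>A subset of \<open>\<real>/T\<int>\<close> is represented by its preimage in \<open>\<real>\<close>; for the image of
  \<open>A\<close> under the quotient map this preimage is the union of the \<open>T\<close>-translates of \<open>A\<close>.\<close>

definition circle_preimage :: "real \<Rightarrow> real set \<Rightarrow> real set" where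
  "circle_preimage T A = (\<Union>k::int. (\<lambda>t. t + of_int k * T) ` A)"

definition absolutely_continuous_on :: "real \<Rightarrow> real \<Rightarrow> (real \<Rightarrow> real) \<Rightarrow> bool" where
  "absolutely_continuous_on c d f \<longleftrightarrow>
     (\<forall>\<epsilon>>0. \<exists>\<delta>>0. \<forall>D. finite D \<and> (\<forall>(x, y)\<in>D. c \<le> x \<and> x \<le> y \<and> y \<le> d) \<and>
        pairwise (\<lambda>(x, y) (x', y'). {x<..<y} \<inter> {x'<..<y'} = {}) D \<and>
        (\<Sum>(x, y)\<in>D. y - x) < \<delta> \<longrightarrow> (\<Sum>(x, y)\<in>D. \<bar>f y - f x\<bar>) < \<epsilon>)"

definition locally_absolutely_continuous :: "(real \<Rightarrow> real) \<Rightarrow> bool" where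
  "locally_absolutely_continuous f \<longleftrightarrow> (\<forall>c d. absolutely_continuous_on c d f)"

text \<open>Solutions on \<open>\<real>\<close>. The nonlinearity \<open>g\<close> is only meaningful on \<open>[0,\<infinity>)\<close>, hence the
  requirement \<open>0 \<le> u t\<close>.\<close>

definition is_solution :: "(real \<Rightarrow> real) \<Rightarrow> (real \<Rightarrow> real) \<Rightarrow> real \<Rightarrow> (real \<Rightarrow> real) \<Rightarrow> bool" where
  "is_solution a g lam u \<longleftrightarrow>
     u C1_differentiable_on UNIV \<and> (\<forall>t. \<bar>deriv u t\<bar> < 1) \<and> (\<forall>t. 0 \<le> u t) \<and>
     locally_absolutely_continuous (\<lambda>t. phi (deriv u t)) \<and>
     (AE t in lebesgue. \<exists>D. ((\<lambda>s. phi (deriv u s)) has_real_derivative D) (at t) \<and>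
        D + lam * a t * g (u t) = 0)"

definition positive_periodic_solution ::
    "real \<Rightarrow> (real \<Rightarrow> real) \<Rightarrow> (real \<Rightarrow> real) \<Rightarrow> real \<Rightarrow> (real \<Rightarrow> real) \<Rightarrow> bool" where
  "positive_periodic_solution T a g lam u \<longleftrightarrow>
     is_solution a g lam u \<and> periodic T u \<and> (\<forall>t. 0 < u t)"

text \<open>The minimum of \<open>g\<close> over a compact interval is written as \<open>Inf\<close>, since \<open>Min\<close> is
  unspecified on infinite sets; for continuous \<open>g\<close> the infimum is attained.\<close>

definition lambda_star ::
    "nat \<Rightarrow> (nat \<Rightarrow> real) \<Rightarrow> (nat \<Rightarrow> real) \<Rightarrow> (real \<Rightarrow> real) \<Rightarrow> (real \<Rightarrow> real) \<Rightarrow> real \<Rightarrow> real" where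
  "lambda_star m \<sigma> \<tau> a g \<rho> =
     (MAX i\<in>{1..m}. 2 * phi (1/2) /
        ((INF u\<in>{2 * \<rho>\<^sup>2 / (\<tau> i - \<sigma> i)..\<rho>}. g u) *
         (LINT t:{\<sigma> i + 2 * \<rho>..\<tau> i - 2 * \<rho>}|lebesgue. a t)))"

text \<open>Smooth functions on \<open>\<real>\<close> with compact (equivalently, bounded) support.\<close>

definition test_function :: "(real \<Rightarrow> real) \<Rightarrow> bool" where
  "test_function \<psi> \<longleftrightarrow>
     (\<forall>k x. (deriv ^^ k) \<psi> differentiable (at x)) \<and> bounded {x. \<psi> x \<noteq> 0}"

definition has_weak_derivative :: "(real \<Rightarrow> real) \<Rightarrow> (real \<Rightarrow> real) \<Rightarrow> bool" where
  "has_weak_derivative u v \<longleftrightarrow> locally_integrable u \<and> locally_integrable v \<and>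
     (\<forall>\<psi>. test_function \<psi> \<longrightarrow>
        (LINT t|lebesgue. u t * deriv \<psi> t) = - (LINT t|lebesgue. v t * \<psi> t))"

text \<open>\<open>has_W1p_norm T p u n\<close> states that \<open>u\<close> lies in the periodic Sobolev space \<open>W\<^sup>1\<^sup>,\<^sup>p\<^sub>T\<close> and
  that \<open>n\<close> is its norm. Weak derivatives being unique almost everywhere, \<open>n\<close> does not
  depend on the choice of \<open>v\<close>.\<close>

definition has_W1p_norm :: "real \<Rightarrow> real \<Rightarrow> (real \<Rightarrow> real) \<Rightarrow> real \<Rightarrow> bool" where
  "has_W1p_norm T p u n \<longleftrightarrow> periodic T u \<and>
     (\<exists>v. has_weak_derivative u v \<and>
        set_integrable lebesgue {0..T} (\<lambda>t. \<bar>u t\<bar> powr p) \<and>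
        set_integrable lebesgue {0..T} (\<lambda>t. \<bar>v t\<bar> powr p) \<and>
        n = ((LINT t:{0..T}|lebesgue. \<bar>u t\<bar> powr p) +
             (LINT t:{0..T}|lebesgue. \<bar>v t\<bar> powr p)) powr (1 / p))"

definition tendsto_W1p ::
    "real \<Rightarrow> real \<Rightarrow> ('i \<Rightarrow> real \<Rightarrow> real) \<Rightarrow> (real \<Rightarrow> real) \<Rightarrow> 'i filter \<Rightarrow> bool" where
  "tendsto_W1p T p U l F \<longleftrightarrow> (\<exists>n. has_W1p_norm T p l n) \<and>
     (\<exists>N. (\<forall>\<^sub>F x in F. has_W1p_norm T p (\<lambda>t. U x t - l t) (N x)) \<and> (N \<longlongrightarrow> 0) F)"

end

theory Submission
  imports Defs
begin

text \<open>
  Call the translates of the intervals \<open>I\<^sub>i\<^sup>+ = [\<sigma> i, \<tau> i]\<close> by multiples of \<open>T\<close> humps. Since \<open>\<phi>\<close> is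
  increasing and \<open>\<phi>(u')\<close> is the integral of \<open>-\<lambda> a g(u)\<close>, a solution is concave on every hump and
  convex between humps. This geometry carries the whole proof.

  Smallness on a hump (\<open>solutions_small_on_hump\<close>): if \<open>u \<ge> \<eta>\<close> at one point of \<open>I\<^sub>i\<^sup>+\<close>, concavity bounds
  \<open>u\<close> from below by a multiple of \<open>\<eta>\<close> on the inner interval \<open>[\<sigma> i + 2\<rho>, \<tau> i - 2\<rho>]\<close>, so that \<open>g(u)\<close>
  is at least some \<open>\<gamma> > 0\<close> there that depends on \<open>\<eta>\<close> but not on \<open>\<lambda>\<close>. Concavity and \<open>0 < u < \<rho>\<close> also give
  \<open>\<bar>u'\<bar> \<le> 1/2\<close> on the inner interval. Integrating the equation over it yields
  \<open>\<lambda> \<gamma> \<integral> a \<le> 2 \<phi>(1/2)\<close>, which is impossible once \<open>\<lambda>\<close> is large.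

  Between the humps a convex function has no larger values than at the ends
  (\<open>periodic_solution_max_principle\<close>), so the convergence is uniform on the whole line.

  Convergence of the derivatives: around a point \<open>t\<close> that is not an end point of a hump, \<open>u'\<close> is
  monotone on an interval \<open>[t - r, t + r]\<close> whose size does not depend on \<open>\<lambda>\<close>, and comparison with the
  tangent at \<open>t\<close> gives \<open>\<bar>u'(t)\<bar> \<le> sup u / r\<close>. Hence \<open>u' \<rightarrow> 0\<close> outside a countable set, and
  \<open>\<bar>u'\<bar> < 1\<close> allows dominated convergence, which gives convergence in every \<open>L\<^sup>p\<close>.

  Two general facts link this argument to the definitions: the fundamental theorem of calculus for
  absolutely continuous functions (\<open>ftc_absolutely_continuous\<close>), which turns the equation, valid only
  almost everywhere, into an integral identity, and the fact that a continuous classical derivative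
  is a weak derivative (\<open>has_weak_derivative_classical\<close>).
\<close>

section \<open>The fundamental theorem of calculus for absolutely continuous functions\<close>

text \<open>Absolute continuity in the form that gauge integration needs. A tagged division may use the same
  degenerate interval with several tags, so its intervals are first collected in a set, where
  distinct intervals have distinct pairs of end points; degenerate intervals contribute nothing.\<close>

lemma absolutely_continuous_on_tagged_sum:
  assumes F: "absolutely_continuous_on c d F" and e: "e > 0"
  obtains \<delta> where "\<delta> > 0"
    "\<And>q. q tagged_partial_division_of {c..d} \<Longrightarrow> (\<Sum>(x, K)\<in>q. measure lborel K) < \<delta>
       \<Longrightarrow> (\<Sum>(x, K)\<in>q. \<bar>F (Sup K) - F (Inf K)\<bar>) < e"
proof -
  obtain \<delta> where \<delta>: "\<delta> > 0" and small: "\<And>D. finite D \<Longrightarrow>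
        (\<forall>(x, y)\<in>D. c \<le> x \<and> x \<le> y \<and> y \<le> d) \<Longrightarrow>
        pairwise (\<lambda>(x, y) (x', y'). {x<..<y} \<inter> {x'<..<y'} = {}) D \<Longrightarrow>
        (\<Sum>(x, y)\<in>D. y - x) < \<delta> \<Longrightarrow> (\<Sum>(x, y)\<in>D. \<bar>F y - F x\<bar>) < e"
    using F e unfolding absolutely_continuous_on_def by meson
  show ?thesis
  proof (rule that[OF \<delta>])
    fix q assume q: "q tagged_partial_division_of {c..d}"
      and len: "(\<Sum>(x, K)\<in>q. measure lborel K) < \<delta>"
    define KK where "KK = snd ` q"
    define ends where "ends = (\<lambda>K :: real set. (Inf K, Sup K))"
    have K: "\<exists>x y. K = {x..y} \<and> x \<le> y \<and> c \<le> x \<and> y \<le> d" if KKK: "K \<in> KK" for K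
    proof -
      obtain t where "(t, K) \<in> q" using KKK unfolding KK_def by auto
      from tagged_partial_division_ofD(2-4)[OF q this] show ?thesis by fastforce
    qed
    have div: "KK division_of \<Union>KK"
      unfolding KK_def by (rule partial_division_of_tagged_division[OF q])
    have fin: "finite KK" using div by auto
    have disj: "interior K \<inter> interior L = {}" if "K \<in> KK" "L \<in> KK" "K \<noteq> L" for K L
      using division_ofD(5)[OF div] that by auto
    have inj: "inj_on ends KK"
    proof (rule inj_onI)
      fix K L assume "K \<in> KK" "L \<in> KK" "ends K = ends L"
      with K[of K] K[of L] show "K = L" by (auto simp: ends_def)
    qed
    have sum_q: "(\<Sum>(x, K)\<in>q. h K) = (\<Sum>K\<in>KK. h K)"
      if h: "\<And>x. h {x..x} = 0" for h :: "real set \<Rightarrow> real"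
    proof -
      have "(\<Sum>(x, K)\<in>q. h K) = (\<Sum>(x, K)\<in>q. if K = {} then 0 else h K)"
        using tagged_partial_division_ofD(2)[OF q] by (intro sum.cong) fastforce+
      also have "\<dots> = (\<Sum>K\<in>snd ` q. if K = {} then 0 else h K)"
      proof (rule sum.over_tagged_division_lemma[OF tagged_partial_division_of_Union_self[OF q]])
        fix x y :: real assume "box x y = {}"
        then show "(if cbox x y = {} then 0 else h (cbox x y)) = 0"
          using h[of x] by (cases "x = y") auto
      qed
      also have "\<dots> = (\<Sum>K\<in>KK. h K)"
        unfolding KK_def[symmetric] using K by (intro sum.cong) fastforce+
      finally show ?thesis .
    qed
    have "(\<Sum>(x, y)\<in>ends ` KK. y - x) = (\<Sum>K\<in>KK. Sup K - Inf K)"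
      by (subst sum.reindex[OF inj]) (simp add: ends_def)
    also have "\<dots> = (\<Sum>K\<in>KK. measure lborel K)"
      using K by (intro sum.cong) fastforce+
    also have "\<dots> = (\<Sum>(x, K)\<in>q. measure lborel K)"
      by (rule sum_q[symmetric]) simp
    finally have "(\<Sum>(x, y)\<in>ends ` KK. y - x) < \<delta>"
      using len by simp
    moreover have "pairwise (\<lambda>(x, y) (x', y'). {x<..<y} \<inter> {x'<..<y'} = {}) (ends ` KK)"
    proof -
      have "{x<..<y} \<inter> {x'<..<y'} = {}"
        if "K \<in> KK" "L \<in> KK" "ends K = (x, y)" "ends L = (x', y')" "(x, y) \<noteq> (x', y')" for K L x y x' y'
      proof -
        have "K \<noteq> L" using that by auto
        then have "interior K \<inter> interior L = {}" using disj that by auto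
        moreover have "interior K = {x<..<y}" "interior L = {x'<..<y'}"
          using K[OF that(1)] K[OF that(2)] that(3,4)
          by (auto simp: ends_def interior_atLeastAtMost_real)
        ultimately show ?thesis by simp
      qed
      then show ?thesis unfolding pairwise_def by (auto simp: ends_def)
    qed
    moreover have "\<forall>(x, y)\<in>ends ` KK. c \<le> x \<and> x \<le> y \<and> y \<le> d"
      using K by (fastforce simp: ends_def)
    ultimately have "(\<Sum>(x, y)\<in>ends ` KK. \<bar>F y - F x\<bar>) < e"
      using fin by (intro small) auto
    also have "(\<Sum>(x, y)\<in>ends ` KK. \<bar>F y - F x\<bar>) = (\<Sum>K\<in>KK. \<bar>F (Sup K) - F (Inf K)\<bar>)"
      by (subst sum.reindex[OF inj]) (simp add: ends_def)
    also have "\<dots> = (\<Sum>(x, K)\<in>q. \<bar>F (Sup K) - F (Inf K)\<bar>)"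
      by (rule sum_q[symmetric]) simp
    finally show "(\<Sum>(x, K)\<in>q. \<bar>F (Sup K) - F (Inf K)\<bar>) < e" .
  qed
qed

text \<open>Let \<open>N\<close> be a null set outside which \<open>f\<close> is the derivative, and set the integrand to \<open>0\<close> on \<open>N\<close>.
  In a fine tagged division, the intervals tagged outside \<open>N\<close> are handled by differentiability as in
  the fundamental theorem for everywhere differentiable functions. Those tagged in \<open>N\<close> lie in an open
  set of small measure, and absolute continuity makes the total increment over them small.\<close>

lemma ftc_absolutely_continuous:
  fixes f F :: "real \<Rightarrow> real"
  assumes cd: "c \<le> d" and F: "absolutely_continuous_on c d F"
    and deriv: "AE t in lebesgue. (F has_real_derivative f t) (at t)"
  shows "(f has_integral F d - F c) {c..d}"
proof -
  obtain N where N: "negligible N" "{t. \<not> (F has_real_derivative f t) (at t)} \<subseteq> N"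
    using deriv unfolding eventually_ae_filter_negligible by auto
  define h where "h = (\<lambda>t. if t \<in> N then 0 else f t)"
  have "(h has_integral F d - F c) {c..d}"
    unfolding has_integral_factor_content_real
  proof (intro allI impI)
    fix e :: real assume e: "e > 0"
    show "\<exists>\<gamma>. gauge \<gamma> \<and> (\<forall>p. p tagged_division_of {c..d} \<and> \<gamma> fine p \<longrightarrow>
        norm ((\<Sum>(x, K)\<in>p. measure lborel K *\<^sub>R h x) - (F d - F c)) \<le> e * measure lborel {c..d})"
    proof (cases "c = d")
      case True
      have "(h has_integral F d - F c) {c..d}" using True by (simp add: has_integral_refl)
      then show ?thesis using e unfolding has_integral_factor_content_real by blast
    next
      case False
      with cd have lt: "c < d" by simp
      \<comment> \<open>One half of the error for the tags outside \<open>N\<close>, one half for the tags in \<open>N\<close>.\<close>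
      define e2 where "e2 = e / 2"
      have e2: "e2 > 0" "e2 * (d - c) > 0" using e lt by (auto simp: e2_def)
      obtain \<delta> where \<delta>: "\<delta> > 0" and ac: "\<And>q. q tagged_partial_division_of {c..d} \<Longrightarrow>
          (\<Sum>(x, K)\<in>q. measure lborel K) < \<delta> \<Longrightarrow> (\<Sum>(x, K)\<in>q. \<bar>F (Sup K) - F (Inf K)\<bar>) < e2 * (d - c)"
        using absolutely_continuous_on_tagged_sum[OF F e2(2)] by blast
      obtain U where U: "open U" "N \<subseteq> U" "U - N \<in> lmeasurable" "emeasure lebesgue (U - N) < ennreal \<delta>"
        using sets_lebesgue_outer_open[OF _ \<delta>] N(1)
        by (metis negligible_imp_measurable fmeasurableD)
      have Um: "U \<in> lmeasurable"
      proof -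
        have "U = (U - N) \<union> N" using U(2) by auto
        then show ?thesis using U(3) negligible_imp_measurable[OF N(1)]
          by (metis fmeasurable.Un)
      qed
      have Uless: "measure lebesgue U < \<delta>"
      proof -
        have "measure lebesgue (U - N) = measure lebesgue U"
          using N(1) Um by (intro measure_Diff_null_set) (auto simp: negligible_iff_null_sets)
        moreover have "measure lebesgue (U - N) < \<delta>"
          using U(3,4) \<delta> by (simp add: emeasure_eq_measure2 ennreal_less_iff)
        ultimately show ?thesis by simp
      qed
      have "\<exists>\<gamma>. \<forall>x. 0 < \<gamma> x \<and> (x \<in> N \<longrightarrow> ball x (\<gamma> x) \<subseteq> U) \<and>
          (x \<notin> N \<longrightarrow> (\<forall>y. \<bar>y - x\<bar> < \<gamma> x \<longrightarrow> \<bar>F y - F x - f x * (y - x)\<bar> \<le> e2 * \<bar>y - x\<bar>))"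
      proof (rule choice, rule allI)
        fix x
        show "\<exists>r>0. (x \<in> N \<longrightarrow> ball x r \<subseteq> U) \<and>
          (x \<notin> N \<longrightarrow> (\<forall>y. \<bar>y - x\<bar> < r \<longrightarrow> \<bar>F y - F x - f x * (y - x)\<bar> \<le> e2 * \<bar>y - x\<bar>))"
        proof (cases "x \<in> N")
          case True
          then show ?thesis using U(1,2) open_contains_ball by (metis subsetD)
        next
          case False
          then have "(F has_derivative (\<lambda>k. f x * k)) (at x)"
            using N(2) by (auto simp: has_field_derivative_def)
          then obtain r where "r > 0"
            "\<forall>y. norm (y - x) < r \<longrightarrow> norm (F y - F x - f x * (y - x)) \<le> e2 * norm (y - x)"
            using e2(1) unfolding has_derivative_at_alt by meson
          then show ?thesis using False by auto
        qed
      qed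
      then obtain \<gamma> where \<gamma>: "\<And>x. 0 < \<gamma> x" "\<And>x. x \<in> N \<Longrightarrow> ball x (\<gamma> x) \<subseteq> U"
        "\<And>x y. x \<notin> N \<Longrightarrow> \<bar>y - x\<bar> < \<gamma> x \<Longrightarrow> \<bar>F y - F x - f x * (y - x)\<bar> \<le> e2 * \<bar>y - x\<bar>"
        by metis
      show ?thesis
      proof (intro exI conjI allI impI)
        show "gauge (\<lambda>x. ball x (\<gamma> x))" using \<gamma>(1) by (intro gauge_ball_dependent) auto
        fix p assume "p tagged_division_of {c..d} \<and> (\<lambda>x. ball x (\<gamma> x)) fine p"
        then have p: "p tagged_division_of {c..d}" and fine: "(\<lambda>x. ball x (\<gamma> x)) fine p" by auto
        define q where "q = {(x, K) \<in> p. x \<in> N}"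
        define E where "E = (\<lambda>(x, K). measure lborel K *\<^sub>R h x - (F (Sup K) - F (Inf K)))"
        have finp: "finite p" using p by auto
        have qp: "q \<subseteq> p" by (auto simp: q_def)
        have q: "q tagged_partial_division_of {c..d}"
          using p qp by (metis tagged_division_of_def tagged_partial_division_subset)
        have pK: "\<exists>y z. K = {y..z} \<and> y \<le> x \<and> x \<le> z" if "(x, K) \<in> p" for x K
          using tagged_division_ofD(2,4)[OF p that] by fastforce
        have content_q: "(\<Sum>(x, K)\<in>q. measure lborel K) < \<delta>"
        proof -
          have "(\<Sum>(x, K)\<in>q. measure lborel K) = (\<Sum>K\<in>snd ` q. measure lborel K)"
            by (rule sum.over_tagged_division_lemma[OF tagged_partial_division_of_Union_self[OF q]])
              (simp add: content_eq_0_interior)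
          also have "\<dots> = (\<Sum>K\<in>snd ` q. measure lebesgue K)"
            using pK qp by (intro sum.cong) fastforce+
          also have "\<dots> = measure lebesgue (\<Union>(snd ` q))"
            by (rule content_division[OF partial_division_of_tagged_division[OF q]])
          also have "\<dots> \<le> measure lebesgue U"
          proof (rule measure_mono_fmeasurable[OF _ _ Um])
            show "\<Union>(snd ` q) \<subseteq> U"
              using fine \<gamma>(2) unfolding fine_def q_def by fastforce
            have "\<Union>(snd ` q) \<in> lmeasurable"
              by (rule lmeasurable_division[OF partial_division_of_tagged_division[OF q]])
            then show "\<Union>(snd ` q) \<in> sets lebesgue" by auto
          qed
          also note Uless
          finally show ?thesis .
        qed
        have part1: "(\<Sum>z\<in>q. \<bar>E z\<bar>) \<le> e2 * (d - c)"
        proof -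
          have "(\<Sum>z\<in>q. \<bar>E z\<bar>) = (\<Sum>(x, K)\<in>q. \<bar>F (Sup K) - F (Inf K)\<bar>)"
            by (intro sum.cong) (auto simp: q_def E_def h_def)
          then show ?thesis using ac[OF q content_q] by simp
        qed
        have part2: "(\<Sum>z\<in>p - q. \<bar>E z\<bar>) \<le> e2 * (d - c)"
        proof -
          have "\<bar>E z\<bar> \<le> e2 * (case z of (x, K) \<Rightarrow> measure lborel K)" if z: "z \<in> p - q" for z
          proof -
            obtain x K where zK: "z = (x, K)" by (cases z)
            have xK: "(x, K) \<in> p" "x \<notin> N" using z zK by (auto simp: q_def)
            obtain y w where yw: "K = {y..w}" "y \<le> x" "x \<le> w" using pK[OF xK(1)] by auto
            have sub: "{y..w} \<subseteq> ball x (\<gamma> x)" using fine xK(1) yw(1) unfolding fine_def by auto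
            have "y \<in> ball x (\<gamma> x)" "w \<in> ball x (\<gamma> x)"
              using subsetD[OF sub] yw by simp_all
            then have "\<bar>y - x\<bar> < \<gamma> x" "\<bar>w - x\<bar> < \<gamma> x" by (auto simp: dist_real_def abs_minus_commute)
            then have 1: "\<bar>F y - F x - f x * (y - x)\<bar> \<le> e2 * \<bar>y - x\<bar>"
                "\<bar>F w - F x - f x * (w - x)\<bar> \<le> e2 * \<bar>w - x\<bar>"
              using \<gamma>(3)[OF xK(2)] by auto
            have "E z = (F y - F x - f x * (y - x)) - (F w - F x - f x * (w - x))"
              using yw xK(2) by (simp add: zK E_def h_def algebra_simps)
            then have "\<bar>E z\<bar> \<le> e2 * \<bar>y - x\<bar> + e2 * \<bar>w - x\<bar>" using 1 by linarith
            also have "\<dots> = e2 * (w - y)" using yw by (simp add: algebra_simps)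
            finally show ?thesis using yw by (simp add: zK)
          qed
          then have "(\<Sum>z\<in>p - q. \<bar>E z\<bar>) \<le> (\<Sum>z\<in>p - q. e2 * (case z of (x, K) \<Rightarrow> measure lborel K))"
            by (rule sum_mono)
          also have "\<dots> \<le> (\<Sum>z\<in>p. e2 * (case z of (x, K) \<Rightarrow> measure lborel K))"
            using finp e2(1) by (intro sum_mono2) (auto split: prod.splits)
          also have "\<dots> = e2 * (\<Sum>(x, K)\<in>p. measure lborel K)" by (simp add: sum_distrib_left)
          also have "(\<Sum>(x, K)\<in>p. measure lborel K) = d - c"
            using additive_content_tagged_division[of p c d] p lt by simp
          finally show ?thesis .
        qed
        have "(\<Sum>(x, K)\<in>p. measure lborel K *\<^sub>R h x) - (F d - F c) = (\<Sum>z\<in>p. E z)"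
          unfolding additive_tagged_division_1[OF cd p, of F, symmetric] E_def
          by (simp add: sum_subtractf case_prod_unfold)
        also have "\<bar>\<dots>\<bar> \<le> (\<Sum>z\<in>p. \<bar>E z\<bar>)" by (rule sum_abs)
        also have "\<dots> = (\<Sum>z\<in>p - q. \<bar>E z\<bar>) + (\<Sum>z\<in>q. \<bar>E z\<bar>)"
          by (rule sum.subset_diff[OF qp finp])
        also have "\<dots> \<le> e * measure lborel {c..d}"
          using part1 part2 lt by (simp add: e2_def)
        finally show "norm ((\<Sum>(x, K)\<in>p. measure lborel K *\<^sub>R h x) - (F d - F c)) \<le> e * measure lborel {c..d}"
          by simp
      qed
    qed
  qed
  then show ?thesis
    by (rule has_integral_spike[OF N(1), rotated]) (auto simp: h_def)
qed

section \<open>Solutions: integral form and monotonicity of the derivative\<close>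

lemma phi_strict_mono:
  assumes "-1 < x" "x < y" "y < 1"
  shows "phi x < phi y"
proof -
  \<comment> \<open>As \<open>sqrt (1 - z\<^sup>2)\<close> is the cosine of \<open>arcsin z\<close>, monotonicity is that of the tangent.\<close>
  have tan: "phi z = tan (arcsin z)" if "-1 < z" "z < 1" for z
    using that by (simp add: phi_def tan_def cos_arcsin)
  have "-(pi/2) < arcsin x" "arcsin x < arcsin y" "arcsin y < pi/2"
    using assms arcsin_lt_bounded[of x] arcsin_lt_bounded[of y]
    by (auto simp: arcsin_less_arcsin)
  then have "tan (arcsin x) < tan (arcsin y)" by (rule tan_monotone)
  then show ?thesis using assms by (simp add: tan)
qed

lemma phi_le_iff:
  assumes "\<bar>x\<bar> < 1" "\<bar>y\<bar> < 1"
  shows "phi x \<le> phi y \<longleftrightarrow> x \<le> y"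
  using assms phi_strict_mono[of x y] phi_strict_mono[of y x] by fastforce

lemma has_integral_nonneg_AE:
  fixes f :: "real \<Rightarrow> real"
  assumes f: "(f has_integral i) {c..d}"
    and nonneg: "AE t in lebesgue. t \<in> {c<..<d} \<longrightarrow> 0 \<le> f t"
  shows "0 \<le> i"
proof -
  obtain N where N: "negligible N" "{t. \<not> (t \<in> {c<..<d} \<longrightarrow> 0 \<le> f t)} \<subseteq> N"
    using nonneg unfolding eventually_ae_filter_negligible by auto
  have "(f has_integral i) {c<..<d}" using f by (simp add: has_integral_Icc_iff_Ioo)
  then have "((\<lambda>t. max 0 (f t)) has_integral i) {c<..<d}"
    by (rule has_integral_spike[OF N(1), rotated]) (use N(2) in auto)
  then show ?thesis by (rule has_integral_nonneg) auto
qed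

lemma solution_derivative:
  assumes "is_solution a g lam u"
  shows "(u has_real_derivative deriv u t) (at t)" and "continuous_on UNIV (deriv u)"
proof -
  obtain D where D: "\<And>x. (u has_vector_derivative D x) (at x)" "continuous_on UNIV D"
    using assms unfolding is_solution_def C1_differentiable_on_def by auto
  have "(u has_real_derivative D x) (at x)" for x
    using D(1) by (simp add: has_real_derivative_iff_has_vector_derivative)
  then have eq: "deriv u = D" by (auto intro: DERIV_imp_deriv)
  show "(u has_real_derivative deriv u t) (at t)"
    using D(1) eq by (simp add: has_real_derivative_iff_has_vector_derivative)
  show "continuous_on UNIV (deriv u)" using D(2) eq by simp
qed

lemma solution_flux:
  assumes sol: "is_solution a g lam u" and cd: "c \<le> d"
  shows "((\<lambda>t. lam * a t * g (u t)) has_integral phi (deriv u c) - phi (deriv u d)) {c..d}"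
proof -
  have "AE t in lebesgue. ((\<lambda>s. phi (deriv u s)) has_real_derivative - (lam * a t * g (u t))) (at t)"
    using sol unfolding is_solution_def
    by (elim conjE, elim eventually_mono) (metis eq_neg_iff_add_eq_0)
  moreover have "absolutely_continuous_on c d (\<lambda>s. phi (deriv u s))"
    using sol unfolding is_solution_def locally_absolutely_continuous_def by auto
  ultimately have "((\<lambda>t. - (lam * a t * g (u t))) has_integral
      phi (deriv u d) - phi (deriv u c)) {c..d}"
    by (intro ftc_absolutely_continuous[OF cd])
  from has_integral_neg[OF this] show ?thesis by simp
qed

text \<open>Where the weight is nonnegative the flux \<open>\<phi>(u')\<close> decreases, and \<open>\<phi>\<close> is increasing: solutions are
  concave there.\<close>

lemma solution_deriv_antimono:
  assumes sol: "is_solution a g lam u" and lam: "lam > 0" and g: "\<And>x. x \<ge> 0 \<Longrightarrow> g x \<ge> 0"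
    and a: "AE t in lebesgue. t \<in> {c..d} \<longrightarrow> a t \<ge> 0"
    and st: "c \<le> s" "s \<le> t" "t \<le> d"
  shows "deriv u t \<le> deriv u s"
proof -
  have "0 \<le> phi (deriv u s) - phi (deriv u t)"
  proof (rule has_integral_nonneg_AE[OF solution_flux[OF sol st(2)]])
    show "AE x in lebesgue. x \<in> {s<..<t} \<longrightarrow> 0 \<le> lam * a x * g (u x)"
      using a st lam g sol by (elim eventually_mono) (auto simp: is_solution_def)
  qed
  moreover have "\<bar>deriv u x\<bar> < 1" for x using sol unfolding is_solution_def by blast
  ultimately show ?thesis by (simp add: phi_le_iff)
qed

text \<open>Convexity of solutions where the weight is nonpositive. The sign is required on the open interval
  only, because the intervals between humps do not contain their end points.\<close>

lemma solution_deriv_mono: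
  assumes sol: "is_solution a g lam u" and lam: "lam > 0" and g: "\<And>x. x \<ge> 0 \<Longrightarrow> g x \<ge> 0"
    and a: "AE t in lebesgue. t \<in> {c<..<d} \<longrightarrow> a t \<le> 0"
    and st: "c \<le> s" "s \<le> t" "t \<le> d"
  shows "deriv u s \<le> deriv u t"
proof -
  have "0 \<le> - (phi (deriv u s) - phi (deriv u t))"
  proof (rule has_integral_nonneg_AE[OF has_integral_neg[OF solution_flux[OF sol st(2)]]])
    show "AE x in lebesgue. x \<in> {s<..<t} \<longrightarrow> 0 \<le> - (lam * a x * g (u x))"
      using a
    proof (elim eventually_mono, intro impI)
      fix x assume "x \<in> {c<..<d} \<longrightarrow> a x \<le> 0" "x \<in> {s<..<t}"
      then have "a x \<le> 0" using st by auto
      moreover have "g (u x) \<ge> 0" using g sol unfolding is_solution_def by auto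
      ultimately show "0 \<le> - (lam * a x * g (u x))"
        using lam by (simp add: mult_nonneg_nonpos mult_nonpos_nonneg)
    qed
  qed
  moreover have "\<bar>deriv u x\<bar> < 1" for x using sol unfolding is_solution_def by blast
  ultimately show ?thesis by (simp add: phi_le_iff)
qed

section \<open>Bounds for nonnegative convex and concave functions\<close>

lemma convex_above_tangent:
  fixes f :: "real \<Rightarrow> real"
  assumes "\<And>x. (f has_real_derivative f' x) (at x)"
    and "\<And>x y. c \<le> x \<Longrightarrow> x \<le> y \<Longrightarrow> y \<le> d \<Longrightarrow> f' x \<le> f' y"
    and "t \<in> {c<..<d}" "x \<in> {c..d}"
  shows "f t + f' t * (x - t) \<le> f x"
proof -
  have "convex_on {c..d} f"
    using assms(1,2) by (intro convex_on_realI[of _ f f']) auto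
  then have "f x - f t \<ge> f' t * (x - t)"
    using assms
    by (intro convex_on_imp_above_tangent[of "{c..d}"])
      (auto simp: interior_atLeastAtMost_real intro: has_field_derivative_at_within)
  then show ?thesis by simp
qed

lemma concave_below_tangent:
  fixes f :: "real \<Rightarrow> real"
  assumes "\<And>x. (f has_real_derivative f' x) (at x)"
    and "\<And>x y. c \<le> x \<Longrightarrow> x \<le> y \<Longrightarrow> y \<le> d \<Longrightarrow> f' y \<le> f' x"
    and "t \<in> {c<..<d}" "x \<in> {c..d}"
  shows "f x \<le> f t + f' t * (x - t)"
proof -
  have "((\<lambda>x. - f x) has_real_derivative - f' x) (at x)" for x
    using assms(1) by (rule DERIV_minus)
  then have "- f t + - f' t * (x - t) \<le> - f x"
    using assms by (intro convex_above_tangent[of "\<lambda>x. - f x" "\<lambda>x. - f' x" c d t x]) auto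
  then show ?thesis by simp
qed

text \<open>The tangent at \<open>t\<close> lies above \<open>f\<close>, hence above \<open>0\<close>, at \<open>t - r\<close> and at \<open>t + r\<close>, while its value at
  \<open>t\<close> is at most \<open>B\<close>; so its slope is at most \<open>B / r\<close> in absolute value.\<close>

lemma concave_deriv_bound:
  fixes f :: "real \<Rightarrow> real"
  assumes f: "\<And>x. (f has_real_derivative f' x) (at x)"
    and mono: "\<And>x y. t - r \<le> x \<Longrightarrow> x \<le> y \<Longrightarrow> y \<le> t + r \<Longrightarrow> f' y \<le> f' x"
    and B: "\<And>x. 0 \<le> f x" "\<And>x. f x \<le> B" and r: "r > 0"
  shows "\<bar>f' t\<bar> \<le> B / r"
proof -
  have tan: "f x \<le> f t + f' t * (x - t)" if "x \<in> {t - r..t + r}" for x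
    using concave_below_tangent[of f f' "t - r" "t + r" t x] f mono r that by auto
  have "f (t + r) \<le> f t + f' t * r" "f (t - r) \<le> f t - f' t * r"
    using tan[of "t + r"] tan[of "t - r"] r by auto
  then have "\<bar>f' t * r\<bar> \<le> B" using B(1)[of "t + r"] B(1)[of "t - r"] B(2)[of t] by linarith
  then show ?thesis using r by (simp add: field_simps abs_mult)
qed

text \<open>The same argument upside down: the tangent is at most \<open>B\<close> at \<open>t - r\<close> and at \<open>t + r\<close>, and at least
  \<open>0\<close> at \<open>t\<close>.\<close>

lemma convex_deriv_bound:
  fixes f :: "real \<Rightarrow> real"
  assumes f: "\<And>x. (f has_real_derivative f' x) (at x)"
    and mono: "\<And>x y. t - r \<le> x \<Longrightarrow> x \<le> y \<Longrightarrow> y \<le> t + r \<Longrightarrow> f' x \<le> f' y"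
    and B: "\<And>x. 0 \<le> f x" "\<And>x. f x \<le> B" and r: "r > 0"
  shows "\<bar>f' t\<bar> \<le> B / r"
proof -
  have tan: "f t + f' t * (x - t) \<le> f x" if "x \<in> {t - r..t + r}" for x
    using convex_above_tangent[of f f' "t - r" "t + r" t x] f mono r that by auto
  have "f t + f' t * r \<le> f (t + r)" "f t - f' t * r \<le> f (t - r)"
    using tan[of "t + r"] tan[of "t - r"] r by auto
  then have "\<bar>f' t * r\<bar> \<le> B" using B(2)[of "t + r"] B(2)[of "t - r"] B(1)[of t] by linarith
  then show ?thesis using r by (simp add: field_simps abs_mult)
qed

text \<open>A nonnegative concave function lies above the two chords that join its value at \<open>s\<close> to the value
  \<open>0\<close> at the end points of the interval. At distance at least \<open>r\<close> from these end points the chords are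
  at least \<open>f s * r / (d - c)\<close> high.\<close>

lemma concave_interior_lower_bound:
  fixes f :: "real \<Rightarrow> real"
  assumes f: "\<And>x. (f has_real_derivative f' x) (at x)"
    and mono: "\<And>x y. c \<le> x \<Longrightarrow> x \<le> y \<Longrightarrow> y \<le> d \<Longrightarrow> f' y \<le> f' x"
    and nonneg: "\<And>x. 0 \<le> f x" and r: "r > 0" and t: "t \<in> {c + r..d - r}" and s: "s \<in> {c..d}"
  shows "f s * r / (d - c) \<le> f t"
proof -
  have cd: "c < t" "t < d" using t r by auto
  have tan: "f x \<le> f t + f' t * (x - t)" if "x \<in> {c..d}" for x
    using concave_below_tangent[of f f' c d t x] f mono cd that by auto
  have s1: "f s \<le> f t + f' t * (s - t)" using tan s cd by auto
  have key: "f s * r \<le> f t * (d - c)"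
  proof (cases "t \<le> s")
    case True
    \<comment> \<open>The tangent at \<open>t\<close> is evaluated at \<open>s\<close> and at the far end point; weighting the two
      inequalities by \<open>t - c\<close> and \<open>s - t\<close> eliminates the slope.\<close>
    have "0 \<le> f t + f' t * (c - t)" using tan[of c] nonneg[of c] cd by auto
    then have "0 \<le> (f t + f' t * (c - t)) * (s - t)" using True by simp
    moreover have "f s * (t - c) \<le> (f t + f' t * (s - t)) * (t - c)"
      using s1 cd by (intro mult_right_mono) auto
    ultimately have "f s * (t - c) \<le> f t * (s - c)" by (simp add: algebra_simps)
    moreover have "f s * r \<le> f s * (t - c)" using nonneg t by (intro mult_left_mono) auto
    moreover have "f t * (s - c) \<le> f t * (d - c)" using nonneg s by (intro mult_left_mono) auto
    ultimately show ?thesis by linarith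
  next
    case False
    have "0 \<le> f t + f' t * (d - t)" using tan[of d] nonneg[of d] cd by auto
    then have "0 \<le> (f t + f' t * (d - t)) * (t - s)" using False by simp
    moreover have "f s * (d - t) \<le> (f t + f' t * (s - t)) * (d - t)"
      using s1 cd by (intro mult_right_mono) auto
    ultimately have "f s * (d - t) \<le> f t * (d - s)" by (simp add: algebra_simps)
    moreover have "f s * r \<le> f s * (d - t)" using nonneg t by (intro mult_left_mono) auto
    moreover have "f t * (d - s) \<le> f t * (d - c)" using nonneg s by (intro mult_left_mono) auto
    ultimately show ?thesis by linarith
  qed
  show ?thesis using key cd by (simp add: field_simps)
qed

section \<open>Solutions on a hump\<close>

text \<open>The quantitative core: the flux \<open>\<phi>(u')\<close> can drop by at most \<open>2 \<phi>(1/2)\<close> over the inner interval, and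
  the drop equals \<open>\<lambda> \<integral> a g(u)\<close>. The margin \<open>2 * r\<close> together with \<open>u \<le> r\<close> is what makes \<open>\<bar>u'\<bar> \<le> 1/2\<close>.\<close>

lemma solution_large_imp_lam_bounded:
  assumes sol: "is_solution a g lam u" and lam: "lam > 0" and g: "\<And>x. x \<ge> 0 \<Longrightarrow> g x \<ge> 0"
    and a_int: "locally_integrable a"
    and a: "AE t in lebesgue. t \<in> {c..d} \<longrightarrow> a t \<ge> 0"
    and r: "r > 0" "4 * r < d - c" and ub: "\<And>t. u t \<le> r"
    and s: "s \<in> {c..d}" "\<eta> \<le> u s"
    and \<gamma>: "\<gamma> \<ge> 0" "\<And>x. \<eta> * (2 * r) / (d - c) \<le> x \<Longrightarrow> x \<le> r \<Longrightarrow> \<gamma> \<le> g x"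
  shows "lam * \<gamma> * (LINT t:{c + 2 * r..d - 2 * r}|lebesgue. a t) \<le> 2 * phi (1/2)"
proof -
  define p q where "p = c + 2 * r" and "q = d - 2 * r"
  have pq: "p \<le> q" "c \<le> p" "q \<le> d" using r by (auto simp: p_def q_def)
  have nonneg: "0 \<le> u t" for t using sol by (auto simp: is_solution_def)
  have d1: "\<bar>deriv u t\<bar> < 1" for t using sol by (auto simp: is_solution_def)
  note mono = solution_deriv_antimono[OF sol lam g a]
  note der = solution_derivative(1)[OF sol]
  have half: "\<bar>deriv u t\<bar> \<le> 1/2" if t: "t \<in> {p..q}" for t
  proof -
    have "\<bar>deriv u t\<bar> \<le> r / (2 * r)"
      using t r by (intro concave_deriv_bound[OF der] mono nonneg ub) (auto simp: p_def q_def)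
    then show ?thesis using r by simp
  qed
  have low: "\<gamma> \<le> g (u t)" if t: "t \<in> {p..q}" for t
  proof (rule \<gamma>(2)[OF _ ub])
    have "\<eta> * (2 * r) / (d - c) \<le> u s * (2 * r) / (d - c)"
      using s(2) r by (intro divide_right_mono mult_right_mono) auto
    also have "\<dots> \<le> u t"
      by (rule concave_interior_lower_bound[OF der mono nonneg])
        (use t r s in \<open>auto simp: p_def q_def\<close>)
    finally show "\<eta> * (2 * r) / (d - c) \<le> u t" .
  qed
  have "(a has_integral (LINT t:{p..q}|lebesgue. a t)) {p..q}"
    using a_int unfolding locally_integrable_def by (intro has_integral_set_lebesgue) auto
  from has_integral_diff[OF solution_flux[OF sol pq(1)] has_integral_mult_right[OF this, of "lam * \<gamma>"]]
  have "0 \<le> phi (deriv u p) - phi (deriv u q) - lam * \<gamma> * (LINT t:{p..q}|lebesgue. a t)"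
  proof (rule has_integral_nonneg_AE)
    show "AE t in lebesgue. t \<in> {p<..<q} \<longrightarrow> 0 \<le> lam * a t * g (u t) - lam * \<gamma> * a t"
      using a
    proof (elim eventually_mono, intro impI)
      fix t assume at: "t \<in> {c..d} \<longrightarrow> 0 \<le> a t" "t \<in> {p<..<q}"
      then have "0 \<le> lam * a t * (g (u t) - \<gamma>)"
        using lam pq low[of t] by auto
      then show "0 \<le> lam * a t * g (u t) - lam * \<gamma> * a t" by (simp add: algebra_simps)
    qed
  qed
  moreover have "phi (deriv u p) \<le> phi (1/2)" "phi (-(1/2)) \<le> phi (deriv u q)"
    using half[of p] half[of q] d1[of p] d1[of q] pq by (auto simp: phi_le_iff)
  moreover have "phi (-(1/2)) = - phi (1/2)" by (simp add: phi_def)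
  ultimately show ?thesis by (simp add: p_def q_def)
qed

text \<open>The threshold \<open>L\<close> depends on \<open>\<eta>\<close>, on the hump and on the bound \<open>r\<close>, but not on the solution: this
  uniformity makes the statement applicable to a whole family of solutions.\<close>

lemma solutions_small_on_hump:
  assumes g_cont: "continuous_on {0..} g" and g_nonneg: "\<And>x. x \<ge> 0 \<Longrightarrow> g x \<ge> 0"
    and g_pos: "\<And>x. x > 0 \<Longrightarrow> g x > 0"
    and a_int: "locally_integrable a"
    and a: "AE t in lebesgue. t \<in> {c..d} \<longrightarrow> a t \<ge> 0"
    and r: "r > 0" "4 * r < d - c"
    and J: "(LINT t:{c + 2 * r..d - 2 * r}|lebesgue. a t) > 0"
    and \<eta>: "\<eta> > 0"
  shows "\<exists>L. \<forall>lam>L. \<forall>u. is_solution a g lam u \<longrightarrow> (\<forall>t. u t \<le> r) \<longrightarrow> (\<forall>s\<in>{c..d}. u s < \<eta>)"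
proof -
  define K where "K = {\<eta> * (2 * r) / (d - c)..r}"
  have Kpos: "x > 0" if "x \<in> K" for x
  proof -
    have "\<eta> * (2 * r) / (d - c) > 0" using r \<eta> by auto
    then show ?thesis using that by (auto simp: K_def)
  qed
  \<comment> \<open>For large \<open>\<eta>\<close> the interval \<open>K\<close> is empty and any positive \<open>\<gamma>\<close> will do.\<close>
  have "\<exists>\<gamma>>0. \<forall>x\<in>K. \<gamma> \<le> g x"
  proof (cases "K = {}")
    case False
    have "continuous_on K g" using g_cont Kpos by (auto elim!: continuous_on_subset intro: less_imp_le)
    then obtain x where "x \<in> K" "\<forall>y\<in>K. g x \<le> g y"
      using continuous_attains_inf[of K g] False by (auto simp: K_def)
    then show ?thesis using g_pos Kpos by blast
  qed (auto intro: exI[of _ 1])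
  then obtain \<gamma> where \<gamma>: "\<gamma> > 0" "\<And>x. x \<in> K \<Longrightarrow> \<gamma> \<le> g x" by blast
  define J where "J = (LINT t:{c + 2 * r..d - 2 * r}|lebesgue. a t)"
  have Jpos: "\<gamma> * J > 0" using J \<gamma>(1) by (simp add: J_def)
  show ?thesis
  proof (intro exI[of _ "max 0 (2 * phi (1/2) / (\<gamma> * J))"] allI impI ballI)
    fix lam u s
    assume lam: "lam > max 0 (2 * phi (1/2) / (\<gamma> * J))" and sol: "is_solution a g lam u"
      and ub: "\<forall>t. u t \<le> r" and s: "s \<in> {c..d}"
    show "u s < \<eta>"
    proof (rule ccontr)
      assume "\<not> u s < \<eta>"
      then have "lam * \<gamma> * J \<le> 2 * phi (1/2)"
        unfolding J_def
        using lam s ub \<gamma>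
        by (intro solution_large_imp_lam_bounded[OF sol _ g_nonneg a_int a r, where \<eta> = \<eta>]) (auto simp: K_def)
      moreover have "2 * phi (1/2) < lam * (\<gamma> * J)"
        using lam Jpos by (simp add: pos_divide_less_eq)
      ultimately show False by (simp add: mult.assoc)
    qed
  qed
qed

section \<open>Periodicity and the maximum principle\<close>

lemma periodic_int_shift:
  assumes "periodic T f"
  shows "f (t + of_int k * T) = f t"
proof -
  interpret periodic_fun_simple f T
    using assms by unfold_locales (simp add: periodic_def)
  show ?thesis by (rule plus_of_int)
qed

lemma periodic_value_in_fundamental_interval:
  assumes "T > 0" "periodic T f"
  obtains t' where "t' \<in> {0..T}" "f t' = f t"
proof -
  define t' where "t' = t + of_int (- \<lfloor>t / T\<rfloor>) * T"
  have "t / T < of_int \<lfloor>t / T\<rfloor> + 1" "of_int \<lfloor>t / T\<rfloor> \<le> t / T" by linarith+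
  then have "t < (of_int \<lfloor>t / T\<rfloor> + 1) * T" "of_int \<lfloor>t / T\<rfloor> * T \<le> t"
    using assms(1) by (simp_all only: pos_divide_less_eq pos_le_divide_eq)
  then have "t' \<in> {0..T}" by (auto simp: t'_def algebra_simps)
  moreover have "f t' = f t" unfolding t'_def by (rule periodic_int_shift[OF assms(2)])
  ultimately show ?thesis using that by blast
qed

lemma periodic_attains_sup:
  fixes f :: "real \<Rightarrow> real"
  assumes "T > 0" "periodic T f" "continuous_on UNIV f"
  obtains t0 where "\<And>t. f t \<le> f t0"
proof -
  have "\<exists>t0\<in>{0..T}. \<forall>t\<in>{0..T}. f t \<le> f t0"
    using assms(1) continuous_on_subset[OF assms(3)] by (intro continuous_attains_sup) auto
  then obtain t0 where t0: "\<forall>t\<in>{0..T}. f t \<le> f t0" by blast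
  have "f t \<le> f t0" for t
    using periodic_value_in_fundamental_interval[OF assms(1,2), of t] t0 by metis
  then show ?thesis using that by blast
qed

lemma periodic_deriv_int_shift:
  fixes f :: "real \<Rightarrow> real"
  assumes "\<And>x. (f has_real_derivative f' x) (at x)" and "periodic T f"
  shows "f' (t + of_int k * T) = f' t"
proof -
  have "((\<lambda>x. f (x + of_int k * T)) has_real_derivative f' (t + of_int k * T)) (at t)"
    using assms(1) by (intro iffD1[OF DERIV_shift])
  then have "(f has_real_derivative f' (t + of_int k * T)) (at t)"
    by (simp add: periodic_int_shift[OF assms(2)])
  then show ?thesis using assms(1) DERIV_unique by blast
qed

text \<open>The preimage is the sum of a compact set and the closed set of all integer multiples of \<open>T\<close>.\<close>

lemma closed_circle_preimage:
  assumes "compact A"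
  shows "closed (circle_preimage T A)"
proof -
  have "circle_preimage T A = (\<Union>x\<in>A. \<Union>y\<in>(\<lambda>x. T *\<^sub>R x) ` \<int>. {x + y})"
    unfolding circle_preimage_def Ints_def by (auto simp: mult.commute)
  then show ?thesis
    using compact_closed_sums[OF assms closed_scaling[OF closed_Ints]] by simp
qed

lemma circle_preimage_int_shift:
  assumes "t \<in> circle_preimage T A"
  shows "t + of_int k * T \<in> circle_preimage T A"
proof -
  obtain j :: int and x where "x \<in> A" "t = x + of_int j * T"
    using assms unfolding circle_preimage_def by auto
  then have "t + of_int k * T = x + of_int (j + k) * T" by (simp add: algebra_simps)
  then show ?thesis using \<open>x \<in> A\<close> unfolding circle_preimage_def by blast
qed

text \<open>\<open>P\<close> stands for the union of the humps. At a maximum point \<open>t0\<close> outside \<open>P\<close> the derivative vanishes;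
  going left from \<open>t0\<close> to the nearest point of \<open>P\<close>, convexity keeps the derivative nonpositive, so
  that this point of \<open>P\<close> is a maximum point too.\<close>

lemma periodic_solution_max_principle:
  assumes sol: "is_solution a g lam u" and lam: "lam > 0" and g: "\<And>x. x \<ge> 0 \<Longrightarrow> g x \<ge> 0"
    and per: "periodic T u" and T: "T > 0"
    and P: "closed P" "P \<noteq> {}" "\<And>t k. t \<in> P \<Longrightarrow> t + of_int k * T \<in> P"
    and a: "AE t in lebesgue. t \<notin> P \<longrightarrow> a t \<le> 0"
    and small: "\<And>t. t \<in> P \<Longrightarrow> u t < \<eta>"
  shows "u t < \<eta>"
proof -
  note der = solution_derivative(1)[OF sol]
  have "continuous_on UNIV u"
    using der by (intro DERIV_continuous_on) (auto intro: has_field_derivative_at_within)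
  then obtain t0 where t0: "\<And>t. u t \<le> u t0" using periodic_attains_sup[OF T per] by blast
  \<comment> \<open>\<open>Sup S\<close> will be the nearest point of \<open>P\<close> to the left of \<open>t0\<close>; periodicity of \<open>P\<close> provides one.\<close>
  define S where "S = P \<inter> {..t0}"
  obtain x where "x \<in> P" using P(2) by auto
  have "S \<noteq> {}"
  proof -
    define k where "k = \<lfloor>(t0 - x) / T\<rfloor>"
    have "of_int k \<le> (t0 - x) / T" unfolding k_def by linarith
    then have "x + of_int k * T \<le> t0" using T by (simp add: field_simps)
    then show ?thesis using P(3)[OF \<open>x \<in> P\<close>, of k] unfolding S_def by auto
  qed
  moreover have bdd: "bdd_above S" unfolding S_def by auto
  moreover have "closed S" using P(1) unfolding S_def by auto
  ultimately have Sin: "Sup S \<in> S" by (rule closed_contains_Sup)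
  define s where "s = Sup S"
  have s: "s \<in> P" "s \<le> t0" using Sin unfolding s_def S_def by auto
  have "t \<notin> P" if "t \<in> {s<..<t0}" for t
    using that cSup_upper[OF _ bdd, of t] unfolding s_def S_def by auto
  then have a0: "AE t in lebesgue. t \<in> {s<..<t0} \<longrightarrow> a t \<le> 0"
    using a by (auto elim: eventually_mono)
  have "deriv u t0 = 0"
    by (rule DERIV_local_max[OF der, of 1]) (use t0 in auto)
  then have "deriv u t \<le> 0" if "s \<le> t" "t \<le> t0" for t
    using solution_deriv_mono[OF sol lam g a0, of t t0] that by auto
  then have "u t0 \<le> u s"
    using der s(2) by (intro DERIV_nonpos_imp_nonincreasing[of s t0 u]) blast+
  then show ?thesis using t0[of t] small[OF s(1)] by linarith
qed

section \<open>Pointwise bounds for the derivative\<close>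

text \<open>The radius \<open>r\<close> is chosen before the solution. As the sign of \<open>a\<close> is given on one interval only, the
  point is moved there by periodicity of the solution.\<close>

lemma deriv_bound_inside_hump:
  assumes g: "\<And>x. x \<ge> 0 \<Longrightarrow> g x \<ge> 0"
    and a: "AE t in lebesgue. t \<in> {c..d} \<longrightarrow> a t \<ge> 0" and t: "t - of_int k * T \<in> {c<..<d}"
  shows "\<exists>r>0. \<forall>lam>0. \<forall>u B. is_solution a g lam u \<longrightarrow> periodic T u \<longrightarrow> (\<forall>x. u x \<le> B) \<longrightarrow>
           \<bar>deriv u t\<bar> \<le> B / r"
proof -
  define t' where "t' = t - of_int k * T"
  define r where "r = min (t' - c) (d - t')"
  have "r > 0" using t by (auto simp: r_def t'_def)
  moreover have "\<bar>deriv u t\<bar> \<le> B / r"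
    if lam: "lam > 0" and sol: "is_solution a g lam u" and per: "periodic T u" and B: "\<forall>x. u x \<le> B"
    for lam u B
  proof -
    note der = solution_derivative(1)[OF sol]
    have "deriv u t = deriv u t'"
      using periodic_deriv_int_shift[OF der per, of t' k] by (simp add: t'_def)
    moreover have "\<bar>deriv u t'\<bar> \<le> B / r"
    proof (rule concave_deriv_bound[OF der _ _ _ \<open>r > 0\<close>])
      fix x y assume "t' - r \<le> x" "x \<le> y" "y \<le> t' + r"
      then show "deriv u y \<le> deriv u x"
        by (intro solution_deriv_antimono[OF sol lam g a]) (auto simp: r_def)
    qed (use B sol in \<open>auto simp: is_solution_def\<close>)
    ultimately show ?thesis by simp
  qed
  ultimately show ?thesis by blast
qed

lemma deriv_bound_off_humps:
  assumes g: "\<And>x. x \<ge> 0 \<Longrightarrow> g x \<ge> 0"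
    and P: "closed P" and a: "AE t in lebesgue. t \<notin> P \<longrightarrow> a t \<le> 0" and t: "t \<notin> P"
  shows "\<exists>r>0. \<forall>lam>0. \<forall>u B. is_solution a g lam u \<longrightarrow> (\<forall>x. u x \<le> B) \<longrightarrow>
           \<bar>deriv u t\<bar> \<le> B / r"
proof -
  have "open (- P)" "t \<in> - P" using P t by auto
  then obtain r where r: "r > 0" "ball t r \<subseteq> - P" using open_contains_ball by blast
  have a': "AE x in lebesgue. x \<in> {t - r<..<t + r} \<longrightarrow> a x \<le> 0"
    using a r(2) by (elim eventually_mono) (auto simp: ball_eq_greaterThanLessThan)
  have "\<bar>deriv u t\<bar> \<le> B / r"
    if lam: "lam > 0" and sol: "is_solution a g lam u" and B: "\<forall>x. u x \<le> B" for lam u B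
  proof (rule convex_deriv_bound[OF solution_derivative(1)[OF sol] _ _ _ r(1)])
    fix x y assume "t - r \<le> x" "x \<le> y" "y \<le> t + r"
    then show "deriv u x \<le> deriv u y"
      by (intro solution_deriv_mono[OF sol lam g a'])
  qed (use B sol in \<open>auto simp: is_solution_def\<close>)
  then show ?thesis using r(1) by blast
qed

section \<open>Sobolev norms of continuously differentiable functions\<close>

lemma lebesgue_integral_continuous_support:
  fixes f :: "real \<Rightarrow> real"
  assumes "continuous_on UNIV f" "\<And>x. x \<notin> {c..d} \<Longrightarrow> f x = 0"
  shows "(LINT t|lebesgue. f t) = integral {c..d} f"
proof -
  have "(LINT t|lebesgue. f t) = (LINT t:{c..d}|lebesgue. f t)"
    unfolding set_lebesgue_integral_def
    by (rule Bochner_Integration.integral_cong) (use assms(2) in \<open>auto simp: indicator_def\<close>)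
  also have "\<dots> = integral {c..d} f"
    using assms(1) continuous_on_subset
    by (intro set_lebesgue_integral_eq_integral absolutely_integrable_continuous_real) blast
  finally show ?thesis .
qed

text \<open>Integration by parts on an interval that contains the support of the test function in its
  interior, so that the boundary terms vanish.\<close>

lemma has_weak_derivative_classical:
  fixes u v :: "real \<Rightarrow> real"
  assumes der: "\<And>x. (u has_real_derivative v x) (at x)" and v: "continuous_on UNIV v"
  shows "has_weak_derivative u v"
proof -
  have u: "continuous_on UNIV u"
    using der by (intro DERIV_continuous_on) (auto intro: has_field_derivative_at_within)
  have "locally_integrable f" if "continuous_on UNIV f" for f :: "real \<Rightarrow> real"
    unfolding locally_integrable_def
    using that continuous_on_subset by (blast intro: absolutely_integrable_continuous_real)
  moreover have "(LINT t|lebesgue. u t * deriv \<psi> t) = - (LINT t|lebesgue. v t * \<psi> t)"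
    if \<psi>: "test_function \<psi>" for \<psi>
  proof -
    have "(deriv ^^ 0) \<psi> differentiable (at x)" "(deriv ^^ 1) \<psi> differentiable (at x)" for x
      using \<psi> unfolding test_function_def by blast+
    then have d\<psi>: "(\<psi> has_real_derivative deriv \<psi> x) (at x)"
      and d2: "deriv \<psi> differentiable (at x)" for x
      by (auto simp: DERIV_deriv_iff_real_differentiable)
    have c\<psi>: "continuous_on UNIV \<psi>" "continuous_on UNIV (deriv \<psi>)"
      using DERIV_isCont[OF d\<psi>] differentiable_imp_continuous_within[OF d2]
      by (auto intro!: continuous_at_imp_continuous_on)
    obtain R where R: "\<And>x. \<psi> x \<noteq> 0 \<Longrightarrow> \<bar>x\<bar> \<le> R"
      using \<psi> unfolding test_function_def bounded_iff by auto
    \<comment> \<open>The extra \<open>1\<close> makes \<open>\<psi>\<close> vanish at the end points \<open>-S\<close> and \<open>S\<close> themselves.\<close>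
    define S where "S = \<bar>R\<bar> + 1"
    have \<psi>0: "\<psi> x = 0" if "\<bar>x\<bar> > R" for x using R[of x] that by auto
    have d\<psi>0: "deriv \<psi> x = 0" if "\<bar>x\<bar> > \<bar>R\<bar>" for x
    proof -
      have "open {x :: real. \<bar>x\<bar> > \<bar>R\<bar>}" by (intro open_Collect_less continuous_intros)
      then have "((\<lambda>_. 0) has_real_derivative deriv \<psi> x) (at x)"
        by (rule has_field_derivative_transform_within_open[OF d\<psi>]) (use that \<psi>0 in auto)
      then show ?thesis using DERIV_const[of 0] by (rule DERIV_unique)
    qed
    have out: "u x * deriv \<psi> x = 0" "v x * \<psi> x = 0" if "x \<notin> {-S..S}" for x
    proof -
      have "\<bar>x\<bar> > \<bar>R\<bar>" "\<bar>x\<bar> > R" using that by (auto simp: S_def)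
      then show "u x * deriv \<psi> x = 0" "v x * \<psi> x = 0" using \<psi>0 d\<psi>0 by simp_all
    qed
    have cont: "continuous_on UNIV (\<lambda>x. u x * deriv \<psi> x)" "continuous_on UNIV (\<lambda>x. v x * \<psi> x)"
      using u v c\<psi> by (auto intro!: continuous_intros)
    have int: "(\<lambda>x. u x * deriv \<psi> x) integrable_on {-S..S}" "(\<lambda>x. v x * \<psi> x) integrable_on {-S..S}"
      using cont continuous_on_subset by (blast intro: integrable_continuous_real)+
    have "((\<lambda>x. u x * deriv \<psi> x + v x * \<psi> x) has_integral u S * \<psi> S - u (-S) * \<psi> (-S)) {-S..S}"
    proof (rule fundamental_theorem_of_calculus)
      fix x
      have "((\<lambda>x. u x * \<psi> x) has_real_derivative u x * deriv \<psi> x + v x * \<psi> x) (at x)"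
        using DERIV_mult[OF der d\<psi>] by (simp add: add.commute mult.commute)
      then show "((\<lambda>x. u x * \<psi> x) has_vector_derivative u x * deriv \<psi> x + v x * \<psi> x)
          (at x within {-S..S})"
        by (auto simp: has_real_derivative_iff_has_vector_derivative[symmetric]
            intro: has_field_derivative_at_within)
    qed (simp add: S_def)
    moreover have "\<psi> S = 0" "\<psi> (-S) = 0" by (auto intro!: \<psi>0 simp: S_def)
    ultimately have "integral {-S..S} (\<lambda>x. u x * deriv \<psi> x + v x * \<psi> x) = 0"
      by (simp add: integral_unique)
    then have "integral {-S..S} (\<lambda>x. u x * deriv \<psi> x) = - integral {-S..S} (\<lambda>x. v x * \<psi> x)"
      using Henstock_Kurzweil_Integration.integral_add[OF int] by simp
    then show ?thesis
      using lebesgue_integral_continuous_support[OF cont(1) out(1)]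
        lebesgue_integral_continuous_support[OF cont(2) out(2)] by simp
  qed
  ultimately show ?thesis using u v unfolding has_weak_derivative_def by blast
qed

lemma has_W1p_norm_classical:
  fixes u v :: "real \<Rightarrow> real"
  assumes der: "\<And>x. (u has_real_derivative v x) (at x)" and v: "continuous_on UNIV v"
    and per: "periodic T u" and p: "p > 0"
  shows "has_W1p_norm T p u (((LINT t:{0..T}|lebesgue. \<bar>u t\<bar> powr p) +
      (LINT t:{0..T}|lebesgue. \<bar>v t\<bar> powr p)) powr (1 / p))"
proof -
  have u: "continuous_on UNIV u"
    using der by (intro DERIV_continuous_on) (auto intro: has_field_derivative_at_within)
  have "set_integrable lebesgue {0..T} (\<lambda>t. \<bar>f t\<bar> powr p)" if "continuous_on UNIV f" for f
    using that p
    by (intro absolutely_integrable_continuous_real continuous_on_powr' continuous_intros)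
      (auto intro: continuous_on_subset)
  then show ?thesis
    unfolding has_W1p_norm_def using per has_weak_derivative_classical[OF der v] u v by blast
qed

lemma set_integral_powr_tendsto_zero:
  fixes w :: "real \<Rightarrow> real \<Rightarrow> real"
  assumes w: "\<forall>\<^sub>F l in at_top. continuous_on UNIV (w l) \<and> (\<forall>t. \<bar>w l t\<bar> \<le> C)"
    and lim: "AE t in lebesgue. ((\<lambda>l. w l t) \<longlongrightarrow> 0) at_top" and p: "p > 0"
  shows "((\<lambda>l. LINT t:{c..d}|lebesgue. \<bar>w l t\<bar> powr p) \<longlongrightarrow> 0) at_top"
proof -
  obtain L where L: "\<And>l. l \<ge> L \<Longrightarrow> continuous_on UNIV (w l)" "\<And>l t. l \<ge> L \<Longrightarrow> \<bar>w l t\<bar> \<le> C"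
    using w unfolding eventually_at_top_linorder by blast
  \<comment> \<open>Dominated convergence asks for measurability at every parameter, but continuity is known only
    for large ones; the family is replaced by \<open>0\<close> elsewhere.\<close>
  define s where "s = (\<lambda>l t. if l \<ge> L then indicator {c..d} t * \<bar>w l t\<bar> powr p else 0 :: real)"
  have meas: "s l \<in> borel_measurable lebesgue" for l
  proof (cases "l \<ge> L")
    case True
    have "w l \<in> borel_measurable borel"
      using L(1)[OF True] by (rule borel_measurable_continuous_onI)
    then have "s l \<in> borel_measurable borel" using True unfolding s_def by simp
    then show ?thesis by (intro measurable_completion) simp
  qed (simp add: s_def)
  have "((\<lambda>l. integral\<^sup>L lebesgue (s l)) \<longlongrightarrow> integral\<^sup>L lebesgue (\<lambda>_ :: real. 0 :: real)) at_top"
  proof (rule integral_dominated_convergence_at_top)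
    show "integrable lebesgue (\<lambda>t. indicator {c..d} t * C powr p :: real)"
      by (intro integrable_mult_left) (auto intro!: integrable_real_indicator simp: emeasure_lborel_Icc_eq)
    show "AE t in lebesgue. ((\<lambda>l. s l t) \<longlongrightarrow> 0) at_top"
      using lim
    proof (elim eventually_mono)
      fix t assume t: "((\<lambda>l. w l t) \<longlongrightarrow> 0) at_top"
      have "((\<lambda>l. \<bar>w l t\<bar> powr p) \<longlongrightarrow> 0) at_top"
        using t p by (intro tendsto_zero_powrI[where b = p]) (auto intro: tendsto_rabs_zero)
      then have "((\<lambda>l. indicator {c..d} t * \<bar>w l t\<bar> powr p) \<longlongrightarrow> 0) at_top"
        by (rule tendsto_mult_right_zero)
      then show "((\<lambda>l. s l t) \<longlongrightarrow> 0) at_top"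
        by (rule Lim_transform_eventually)
          (rule eventually_mono[OF eventually_ge_at_top[of L]], simp add: s_def)
    qed
    show "\<forall>\<^sub>F l in at_top. AE t in lebesgue. norm (s l t) \<le> indicator {c..d} t * C powr p"
      using eventually_ge_at_top[of L]
    proof (elim eventually_mono)
      fix l assume l: "l \<ge> L"
      have "norm (s l t) \<le> indicator {c..d} t * C powr p" for t
        using L(2)[OF l, of t] p l
        by (auto simp: s_def indicator_def intro: powr_mono2)
      then show "AE t in lebesgue. norm (s l t) \<le> indicator {c..d} t * C powr p" by simp
    qed
  qed (use meas in auto)
  then have "((\<lambda>l. integral\<^sup>L lebesgue (s l)) \<longlongrightarrow> 0) at_top" by simp
  then show ?thesis
    by (rule Lim_transform_eventually)
      (rule eventually_mono[OF eventually_ge_at_top[of L]],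
        simp add: s_def set_lebesgue_integral_def)
qed

section \<open>Convergence to zero\<close>

theorem theorem4p1:
  fixes T \<rho> :: real and a g :: "real \<Rightarrow> real" and m :: nat
    and \<sigma> \<tau> :: "nat \<Rightarrow> real" and u :: "real \<Rightarrow> real \<Rightarrow> real"
  assumes T: "T > 0"
    and a_int: "locally_integrable a" and a_per: "periodic T a"
    and a_neg_mean: "(LINT t:{0..T}|lebesgue. a t) < 0"
    and m: "m \<ge> 1"
    and intervals: "\<And>i. i \<in> {1..m} \<Longrightarrow> \<sigma> i < \<tau> i"
    and disjoint: "disjoint_family_on (\<lambda>i. circle_preimage T {\<sigma> i..\<tau> i}) {1..m}"
    and a_nonneg: "\<And>i. i \<in> {1..m} \<Longrightarrow> AE t in lebesgue. t \<in> {\<sigma> i..\<tau> i} \<longrightarrow> a t \<ge> 0"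
    and a_nonzero: "\<And>i. i \<in> {1..m} \<Longrightarrow> \<not> (AE t in lebesgue. t \<in> {\<sigma> i..\<tau> i} \<longrightarrow> a t = 0)"
    and a_nonpos: "AE t in lebesgue.
      t \<notin> (\<Union>i\<in>{1..m}. circle_preimage T {\<sigma> i..\<tau> i}) \<longrightarrow> a t \<le> 0"
    and g_cont: "continuous_on {0..} g"
    and g_zero: "g 0 = 0" and g_pos: "\<And>x. x > 0 \<Longrightarrow> g x > 0"
    and g_cases:
      "(((\<lambda>x. g x / x) \<longlongrightarrow> 0) (at_right 0) \<and>
        ((\<lambda>(x, \<omega>). g (\<omega> * x) / g x) \<longlongrightarrow> 1) (at_right 0 \<times>\<^sub>F at 1))
       \<or>
       (\<exists>\<epsilon>>0. \<exists>g'. (\<forall>x\<in>{0..<\<epsilon>}. (g has_real_derivative g' x) (at x within {0..<\<epsilon>})) \<and>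
          continuous_on {0..<\<epsilon>} g' \<and> g' 0 = 0)"
    and \<rho>_pos: "\<rho> > 0"
    and \<rho>_small: "\<And>i. i \<in> {1..m} \<Longrightarrow> \<rho> < (\<tau> i - \<sigma> i) / 4"
    and \<rho>_int: "\<And>i. i \<in> {1..m} \<Longrightarrow>
      (LINT t:{\<sigma> i + 2 * \<rho>..\<tau> i - 2 * \<rho>}|lebesgue. a t) > 0"
    and u_sol: "\<And>lam. lam > lambda_star m \<sigma> \<tau> a g \<rho> \<Longrightarrow> positive_periodic_solution T a g lam (u lam)"
    and u_small: "\<And>lam. lam > lambda_star m \<sigma> \<tau> a g \<rho> \<Longrightarrow> (SUP t. \<bar>u lam t\<bar>) < \<rho>"
  shows "(\<forall>p\<ge>1. tendsto_W1p T p u (\<lambda>t. 0) at_top) \<and>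
         uniform_limit UNIV u (\<lambda>t. 0) at_top"
proof -
  \<comment> \<open>The sign of \<open>\<lambda>\<close> decides between concavity and convexity, hence the maximum with \<open>0\<close>.\<close>
  define L where "L = max 0 (lambda_star m \<sigma> \<tau> a g \<rho>)"
  define P where "P = (\<Union>i\<in>{1..m}. circle_preimage T {\<sigma> i..\<tau> i})"
  have g_nonneg: "g x \<ge> 0" if "x \<ge> 0" for x
    using g_zero g_pos that by (cases "x = 0") (auto intro: less_imp_le)
  have sol: "is_solution a g lam (u lam)" and per: "periodic T (u lam)"
    and pos: "0 \<le> u lam t" and lam_pos: "lam > 0" if "lam > L" for lam t
    using u_sol[of lam] that unfolding positive_periodic_solution_def L_def by (auto intro: less_imp_le)
  have der: "(u lam has_real_derivative deriv (u lam) t) (at t)"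
    and cont': "continuous_on UNIV (deriv (u lam))" if "lam > L" for lam t
    using solution_derivative[OF sol[OF that]] by auto
  have cont: "continuous_on UNIV (u lam)" if "lam > L" for lam
    using der[OF that] by (intro DERIV_continuous_on) (auto intro: has_field_derivative_at_within)
  have le_\<rho>: "u lam t \<le> \<rho>" if lam: "lam > L" for lam t
  proof -
    obtain t0 where t0: "\<And>t. u lam t \<le> u lam t0"
      using periodic_attains_sup[OF T per[OF lam] cont[OF lam]] by blast
    have "bdd_above (range (\<lambda>t. \<bar>u lam t\<bar>))"
      using t0 pos[OF lam] by (intro bdd_aboveI[of _ "u lam t0"]) auto
    then have "\<bar>u lam t\<bar> \<le> (SUP t. \<bar>u lam t\<bar>)" by (intro cSUP_upper) auto
    then show ?thesis using u_small[of lam] lam by (auto simp: L_def)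
  qed

  have P_closed: "closed P"
    unfolding P_def by (intro closed_UN ballI closed_circle_preimage) auto
  have P_shift: "t + of_int k * T \<in> P" if "t \<in> P" for t k
    using that circle_preimage_int_shift unfolding P_def by blast
  have P_eq: "t \<in> P \<longleftrightarrow> (\<exists>i\<in>{1..m}. \<exists>k::int. t - of_int k * T \<in> {\<sigma> i..\<tau> i})" for t
    unfolding P_def circle_preimage_def by (force simp: algebra_simps image_iff)
  have P_ne: "P \<noteq> {}"
  proof -
    have "\<sigma> 1 \<in> P"
      unfolding P_eq using m intervals[of 1] by (intro bexI[of _ 1] exI[of _ 0]) auto
    then show ?thesis by auto
  qed
  have a_nonpos': "AE t in lebesgue. t \<notin> P \<longrightarrow> a t \<le> 0" using a_nonpos by (simp add: P_def)

  have small: "\<forall>\<^sub>F lam in at_top. \<forall>t. u lam t < \<eta>" if \<eta>: "\<eta> > 0" for \<eta>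
  proof -
    have "\<forall>\<^sub>F lam in at_top. \<forall>s\<in>{\<sigma> i..\<tau> i}. u lam s < \<eta>" if i: "i \<in> {1..m}" for i
    proof -
      have "4 * \<rho> < \<tau> i - \<sigma> i" using \<rho>_small[OF i] by simp
      then have "\<exists>L. \<forall>lam>L. \<forall>v. is_solution a g lam v \<longrightarrow> (\<forall>t. v t \<le> \<rho>) \<longrightarrow>
          (\<forall>s\<in>{\<sigma> i..\<tau> i}. v s < \<eta>)"
        by (intro solutions_small_on_hump[OF g_cont _ _ a_int a_nonneg[OF i] \<rho>_pos _ \<rho>_int[OF i] \<eta>]
            g_nonneg g_pos)
      then obtain L' where L': "\<forall>lam>L'. \<forall>v. is_solution a g lam v \<longrightarrow> (\<forall>t. v t \<le> \<rho>) \<longrightarrow>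
          (\<forall>s\<in>{\<sigma> i..\<tau> i}. v s < \<eta>)"
        by (elim exE)
      from eventually_gt_at_top[of "max L L'"] show ?thesis
      proof eventually_elim
        case (elim lam)
        then have "lam > L" "lam > L'" by auto
        moreover have "\<forall>t. u lam t \<le> \<rho>" using le_\<rho>[OF \<open>lam > L\<close>] by blast
        ultimately show ?case using L' sol[of lam] by blast
      qed
    qed
    then have "\<forall>\<^sub>F lam in at_top. \<forall>i\<in>{1..m}. \<forall>s\<in>{\<sigma> i..\<tau> i}. u lam s < \<eta>"
      by (intro eventually_ball_finite) auto
    then show ?thesis
      using eventually_gt_at_top[of L]
    proof eventually_elim
      case (elim lam)
      have on_P: "u lam t < \<eta>" if tP: "t \<in> P" for t
      proof -
        obtain i k where "i \<in> {1..m}" "t - of_int k * T \<in> {\<sigma> i..\<tau> i}" using tP unfolding P_eq by blast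
        then have "u lam (t - of_int k * T) < \<eta>" using elim(1) by blast
        then show ?thesis
          using periodic_int_shift[OF per[OF elim(2)], of "t - of_int k * T" k] by simp
      qed
      show ?case
        by (rule allI, rule periodic_solution_max_principle[OF sol[OF elim(2)] lam_pos[OF elim(2)] _
            per[OF elim(2)] T P_closed P_ne _ a_nonpos']) (fact g_nonneg P_shift on_P)+
    qed
  qed

  have unif: "uniform_limit UNIV u (\<lambda>t. 0) at_top"
  proof (rule uniform_limitI)
    fix e :: real assume "e > 0"
    from small[OF this] eventually_gt_at_top[of L]
    show "\<forall>\<^sub>F lam in at_top. \<forall>t\<in>UNIV. dist (u lam t) 0 < e"
      by eventually_elim (use pos in \<open>auto simp: dist_real_def\<close>)
  qed

  \<comment> \<open>Near an end point of a hump \<open>u'\<close> need not be monotone; these points form a countable set.\<close>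
  define E where "E = (\<Union>i\<in>{1..m}. \<Union>k::int. {\<sigma> i + of_int k * T, \<tau> i + of_int k * T})"
  have deriv_lim: "((\<lambda>lam. deriv (u lam) t) \<longlongrightarrow> 0) at_top" if t: "t \<notin> E" for t
  proof -
    have "\<exists>r>0. \<forall>lam>0. \<forall>v B. is_solution a g lam v \<longrightarrow> periodic T v \<longrightarrow> (\<forall>x. v x \<le> B) \<longrightarrow>
           \<bar>deriv v t\<bar> \<le> B / r"
    proof (cases "t \<in> P")
      case True
      then obtain i k where i: "i \<in> {1..m}" and k: "t - of_int k * T \<in> {\<sigma> i..\<tau> i}"
        unfolding P_eq by blast
      have "t \<noteq> \<sigma> i + of_int k * T" "t \<noteq> \<tau> i + of_int k * T" using t i unfolding E_def by blast+
      then have "t - of_int k * T \<in> {\<sigma> i<..<\<tau> i}" using k by auto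
      then show ?thesis by (intro deriv_bound_inside_hump[OF _ a_nonneg[OF i]] g_nonneg)
    next
      case False
      have "\<exists>r>0. \<forall>lam>0. \<forall>v B. is_solution a g lam v \<longrightarrow>
          (\<forall>x. v x \<le> B) \<longrightarrow> \<bar>deriv v t\<bar> \<le> B / r"
        by (intro deriv_bound_off_humps[OF _ P_closed a_nonpos' False] g_nonneg)
      then obtain r where "r > 0" and "\<forall>lam>0. \<forall>v B. is_solution a g lam v \<longrightarrow>
          (\<forall>x. v x \<le> B) \<longrightarrow> \<bar>deriv v t\<bar> \<le> B / r"
        by (elim exE conjE)
      then show ?thesis by (intro exI[of _ r]) simp
    qed
    then obtain r where r: "r > 0" and bound: "\<forall>lam>0. \<forall>v B. is_solution a g lam v \<longrightarrow>
        periodic T v \<longrightarrow> (\<forall>x. v x \<le> B) \<longrightarrow> \<bar>deriv v t\<bar> \<le> B / r"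
      by (elim exE conjE)
    show ?thesis
    proof (rule tendstoI)
      fix e :: real assume e: "e > 0"
      then have "e / 2 * r > 0" using r by simp
      from small[OF this] eventually_gt_at_top[of L]
      show "\<forall>\<^sub>F lam in at_top. dist (deriv (u lam) t) 0 < e"
      proof eventually_elim
        case (elim lam)
        have "\<forall>x. u lam x \<le> e / 2 * r" using elim(1) less_imp_le by blast
        then have "\<bar>deriv (u lam) t\<bar> \<le> e / 2 * r / r"
          using bound lam_pos[OF elim(2)] sol[OF elim(2)] per[OF elim(2)] by blast
        then show ?case using r e by simp
      qed
    qed
  qed
  have "countable E" unfolding E_def by auto
  then have "AE t in lebesgue. t \<notin> E"
    by (intro AE_completion AE_not_in countable_imp_null_set_lborel)
  then have deriv_lim_AE: "AE t in lebesgue. ((\<lambda>lam. deriv (u lam) t) \<longlongrightarrow> 0) at_top"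
    by (rule eventually_mono) (rule deriv_lim)

  have "tendsto_W1p T p u (\<lambda>t. 0) at_top" if "p \<ge> 1" for p
  proof -
    have p: "p > 0" using that by simp
    define A where "A = (\<lambda>lam. LINT t:{0..T}|lebesgue. \<bar>u lam t\<bar> powr p)"
    define B where "B = (\<lambda>lam. LINT t:{0..T}|lebesgue. \<bar>deriv (u lam) t\<bar> powr p)"
    have "(A \<longlongrightarrow> 0) at_top"
      unfolding A_def
    proof (rule set_integral_powr_tendsto_zero[OF _ _ p])
      show "\<forall>\<^sub>F lam in at_top. continuous_on UNIV (u lam) \<and> (\<forall>t. \<bar>u lam t\<bar> \<le> \<rho>)"
        using eventually_gt_at_top[of L] by eventually_elim (use cont pos le_\<rho> in auto)
      show "AE t in lebesgue. ((\<lambda>lam. u lam t) \<longlongrightarrow> 0) at_top"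
        using tendsto_uniform_limitI[OF unif] by auto
    qed
    moreover have "(B \<longlongrightarrow> 0) at_top"
      unfolding B_def
    proof (rule set_integral_powr_tendsto_zero[OF _ deriv_lim_AE p])
      show "\<forall>\<^sub>F lam in at_top. continuous_on UNIV (deriv (u lam)) \<and> (\<forall>t. \<bar>deriv (u lam) t\<bar> \<le> 1)"
        using eventually_gt_at_top[of L]
        by eventually_elim (use cont' sol in \<open>auto simp: is_solution_def intro: less_imp_le\<close>)
    qed
    ultimately have "((\<lambda>lam. A lam + B lam) \<longlongrightarrow> 0) at_top" using tendsto_add_zero by blast
    moreover have "0 \<le> A lam + B lam" for lam
      unfolding A_def B_def set_lebesgue_integral_def
      by (intro add_nonneg_nonneg Bochner_Integration.integral_nonneg) auto
    ultimately have "((\<lambda>lam. (A lam + B lam) powr (1 / p)) \<longlongrightarrow> 0) at_top"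
      using p by (intro tendsto_zero_powrI[where b = "1 / p"]) auto
    moreover have "\<forall>\<^sub>F lam in at_top.
        has_W1p_norm T p (\<lambda>t. u lam t - 0) ((A lam + B lam) powr (1 / p))"
      using eventually_gt_at_top[of L]
      by eventually_elim
        (use has_W1p_norm_classical[OF der cont' per p] in \<open>simp add: A_def B_def\<close>)
    moreover have "has_W1p_norm T p (\<lambda>t. 0) (((LINT t:{0..T}|lebesgue. \<bar>0 :: real\<bar> powr p) +
        (LINT t:{0..T}|lebesgue. \<bar>0 :: real\<bar> powr p)) powr (1 / p))"
      using p by (intro has_W1p_norm_classical) (auto simp: periodic_def)
    ultimately show ?thesis
      unfolding tendsto_W1p_def
      by (intro conjI exI[of _ "\<lambda>lam. (A lam + B lam) powr (1 / p)"]) blast+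
  qed
  then show ?thesis using unif by blast
qed

end
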